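(* Fix an integer $n\ge 2$. The cyclic Tamari lattice $\mathsf{CTam}_{312}$ and the affine Tamari lattice $\mathsf{ATam}_{312}$ are semidistributive lattices.
   Context: Fix an integer $n\ge 2$. A translation-invariant total order (TITO) is a total order $\preceq$ on $\mathbb Z$ such that $a\preceq b$ iff $a+n\preceq b+n$. A reflection index is a pair $(a,b)$ of integers with $a<b$, up to simultaneous translation by multiples of $n$; it is an inversion of $\preceq$ if $b\preceq a$. TITOs are partially ordered by containment of inversion sets. A TITO is $312$-avoiding if there are no integers $a<b<c$ with $c\preceq a\preceq b$. A block of a TITO is a nonempty order-convex subset $I\subseteq\mathbb Z$ with no minimal or maximal element in which all intervals between two elements are finite; its size is the number of residue classes modulo $n$ it contains; it is waxing if $x\preceq x+n$ for $x\in I$ and waning otherwise. A TITO is real if every block of size $1$ is waxing. $\mathsf{CTam}_{312}$ (resp. $\mathsf{ATam}_{312}$) is the poset of $312$-avoiding (resp. $312$-avoiding real) TITOs with the induced order; both are finite lattices. A finite lattice $L$ is meet-semidistributive if for all $x\le y$ in $L$ the set $\{z\in L\mid z\wedge y=x\}$, when nonempty, has a maximum element; join-semidistributive if its dual is meet-semidistributive; semidistributive if both. *)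

theory Defs
  imports "HOL-Algebra.Lattice"
begin

text \<open>
  A binary relation on the integers is a set \<open>r\<close> of pairs, and \<open>(a, b) \<in> r\<close> is read as
  "\<open>a\<close> precedes or equals \<open>b\<close>".
\<close>

definition tito :: "nat \<Rightarrow> int rel \<Rightarrow> bool" where
  "tito n r \<longleftrightarrow>
     linear_order_on UNIV r \<and>
     (\<forall>a b. (a, b) \<in> r \<longleftrightarrow> (a + int n, b + int n) \<in> r)"

definition translation_equiv :: "nat \<Rightarrow> (int \<times> int) rel" where
  "translation_equiv n =
     {((a, b), (c, d)). a < b \<and> (\<exists>k :: int. c = a + k * int n \<and> d = b + k * int n)}"

text \<open>
  Pairs \<open>a < b\<close> with \<open>a\<close> and \<open>b\<close> congruent modulo \<open>n\<close> are reflection indices too; they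
  record whether the residue class of \<open>a\<close> is increasing or decreasing.
\<close>

definition reflection_indices :: "nat \<Rightarrow> (int \<times> int) set set" where
  "reflection_indices n = {(a, b). a < b} // translation_equiv n"

text \<open>
  For a TITO, whether a pair is inverted does not depend on the chosen representative of
  its class.
\<close>

definition inversions :: "nat \<Rightarrow> int rel \<Rightarrow> (int \<times> int) set set" where
  "inversions n r = {t \<in> reflection_indices n. \<exists>(a, b) \<in> t. (b, a) \<in> r}"

definition avoids_312 :: "int rel \<Rightarrow> bool" where
  "avoids_312 r \<longleftrightarrow> \<not> (\<exists>a b c. a < b \<and> b < c \<and> (c, a) \<in> r \<and> (a, b) \<in> r)"

definition order_convex :: "int rel \<Rightarrow> int set \<Rightarrow> bool" where
  "order_convex r I \<longleftrightarrow>
     (\<forall>x\<in>I. \<forall>y\<in>I. \<forall>z. (x, z) \<in> r \<and> (z, y) \<in> r \<longrightarrow> z \<in> I)"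

definition block :: "int rel \<Rightarrow> int set \<Rightarrow> bool" where
  "block r I \<longleftrightarrow>
     I \<noteq> {} \<and>
     order_convex r I \<and>
     \<not> (\<exists>m\<in>I. \<forall>x\<in>I. (m, x) \<in> r) \<and>
     \<not> (\<exists>m\<in>I. \<forall>x\<in>I. (x, m) \<in> r) \<and>
     (\<forall>x\<in>I. \<forall>y\<in>I. finite {z. (x, z) \<in> r \<and> (z, y) \<in> r})"

definition block_size :: "nat \<Rightarrow> int set \<Rightarrow> nat" where
  "block_size n I = card ((\<lambda>x. x mod int n) ` I)"

definition waxing :: "nat \<Rightarrow> int rel \<Rightarrow> int set \<Rightarrow> bool" where
  "waxing n r I \<longleftrightarrow> (\<forall>x\<in>I. (x, x + int n) \<in> r)"

definition real_tito :: "nat \<Rightarrow> int rel \<Rightarrow> bool" where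
  "real_tito n r \<longleftrightarrow>
     tito n r \<and> (\<forall>I. block r I \<and> block_size n I = 1 \<longrightarrow> waxing n r I)"

definition inversion_order :: "nat \<Rightarrow> int rel set \<Rightarrow> int rel gorder" where
  "inversion_order n X =
     \<lparr>carrier = X, eq = (=), le = (\<lambda>r s. inversions n r \<subseteq> inversions n s)\<rparr>"

definition CTam312 :: "nat \<Rightarrow> int rel gorder" where
  "CTam312 n = inversion_order n {r. tito n r \<and> avoids_312 r}"

definition ATam312 :: "nat \<Rightarrow> int rel gorder" where
  "ATam312 n = inversion_order n {r. real_tito n r \<and> avoids_312 r}"

definition finite_lattice :: "('a, 'b) gorder_scheme \<Rightarrow> bool" where
  "finite_lattice L \<longleftrightarrow> lattice L \<and> finite (carrier L)"

definition meet_semidistributive :: "('a, 'b) gorder_scheme \<Rightarrow> bool" where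
  "meet_semidistributive L \<longleftrightarrow>
     (\<forall>x\<in>carrier L. \<forall>y\<in>carrier L. x \<sqsubseteq>\<^bsub>L\<^esub> y \<longrightarrow>
        {z \<in> carrier L. z \<sqinter>\<^bsub>L\<^esub> y = x} \<noteq> {} \<longrightarrow>
        (\<exists>g. greatest L g {z \<in> carrier L. z \<sqinter>\<^bsub>L\<^esub> y = x}))"

definition join_semidistributive :: "('a, 'b) gorder_scheme \<Rightarrow> bool" where
  "join_semidistributive L \<longleftrightarrow> meet_semidistributive (inv_gorder L)"

definition semidistributive :: "('a, 'b) gorder_scheme \<Rightarrow> bool" where
  "semidistributive L \<longleftrightarrow> meet_semidistributive L \<and> join_semidistributive L"

end

theory Submission
  imports Defs
begin

text \<open>
  A total order on \<open>\<int>\<close> is determined by its set \<open>J\<close> of inverted pairs \<open>a < b\<close>, and such a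
  \<open>J\<close> comes from a total order iff both \<open>J\<close> and its complement (among the pairs \<open>a < b\<close>)
  are transitive. Avoiding \<open>312\<close> means that \<open>(a, c) \<in> J\<close> forces \<open>(a, b) \<in> J\<close> whenever
  \<open>a < b < c\<close>, and this already makes the complement transitive. So the \<open>312\<close>-avoiding TITOs
  correspond to the transitive translation-invariant \<open>J\<close> with this closure property, called
  bracket relations here: they are the bracket vectors of Tamari lattice theory, with \<open>a\<close>
  mapped to the largest \<open>b\<close> (possibly infinity) such that \<open>b = a\<close> or \<open>(a, b) \<in> J\<close>. Bracket relations are
  closed under intersection, and the transitive closure of a union of bracket relations is again
  one. Hence meets are intersections and joins are transitive closures of unions.

  Both semidistributive laws follow from this description of joins. If \<open>z \<inter> y = x\<close> for all
  \<open>z \<in> Z\<close>, then a chain of steps from members of \<open>Z\<close> that joins two points related by \<open>y\<close>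
  stays in \<open>x\<close>, link by link (\<open>bracket_meet_semidistributive\<close>). If \<open>z \<squnion> y = x\<close> for all
  \<open>z \<in> Z\<close>, then a pair of \<open>x\<close> either lies in all the relations \<open>z \<union> y\<close> or splits into two
  shorter pairs of \<open>x\<close>, so induction on the length shows that it lies in the join of \<open>y\<close> with
  the intersection of \<open>Z\<close> (\<open>bracket_join_semidistributive\<close>).

  For the affine lattice, call the class of \<open>a\<close> waning if \<open>(a, a + n) \<in> J\<close>. A \<open>312\<close>-avoiding TITO
  is real iff its number of waning classes is not one (\<open>real_tito_iff_real_part\<close>). Cutting a single waning
  class down to its pairs of length less than \<open>n\<close> gives the largest real relation below \<open>J\<close>,
  and this coreflection preserves joins (\<open>real_part_join\<close>). The affine lattice is thus a lattice
  quotient of the cyclic one, and semidistributivity passes to it. The argument is carried out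
  for an arbitrary join-preserving coreflection \<open>R\<close>: the cyclic lattice is the case \<open>R = id\<close>.
\<close>

section \<open>Translation-invariant relations\<close>

definition translation_invariant :: "nat \<Rightarrow> int rel \<Rightarrow> bool" where
  "translation_invariant n r \<longleftrightarrow> (\<forall>a b. (a, b) \<in> r \<longleftrightarrow> (a + int n, b + int n) \<in> r)"

lemma translation_invariantD:
  assumes "translation_invariant n r"
  shows "(a + int n, b + int n) \<in> r \<longleftrightarrow> (a, b) \<in> r"
  using assms by (simp add: translation_invariant_def)

lemma translation_invariant_shift:
  assumes r: "translation_invariant n r"
  shows "(a + k * int n, b + k * int n) \<in> r \<longleftrightarrow> (a, b) \<in> r"
proof -
  have nat: "(a + int j * int n, b + int j * int n) \<in> r \<longleftrightarrow> (a, b) \<in> r" for a b j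
  proof (induction j)
    case (Suc j)
    have "a + int (Suc j) * int n = (a + int j * int n) + int n"
      "b + int (Suc j) * int n = (b + int j * int n) + int n"
      by (simp_all add: algebra_simps)
    then show ?case
      using Suc by (simp only: translation_invariantD[OF r])
  qed simp
  show ?thesis
  proof (cases "k \<ge> 0")
    case True
    then show ?thesis using nat[of a "nat k" b] by simp
  next
    case False
    then show ?thesis
      using nat[of "a + k * int n" "nat (- k)" "b + k * int n"] by simp
  qed
qed

lemma translation_invariant_Inter:
  assumes "\<And>r. r \<in> X \<Longrightarrow> translation_invariant n r"
  shows "translation_invariant n (\<Inter>X)"
  unfolding translation_invariant_def
  using translation_invariantD[OF assms] by blast

lemma translation_invariant_trancl_Union:
  assumes X: "\<And>r. r \<in> X \<Longrightarrow> translation_invariant n r"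
  shows "translation_invariant n ((\<Union>X)\<^sup>+)"
proof -
  have shift: "(a + k * int n, b + k * int n) \<in> (\<Union>X)\<^sup>+" if "(a, b) \<in> (\<Union>X)\<^sup>+" for a b k
    using that
  proof (induction rule: trancl_induct)
    case (base b)
    then show ?case using translation_invariant_shift[OF X] by blast
  next
    case (step b c)
    then have "(b + k * int n, c + k * int n) \<in> \<Union>X"
      using translation_invariant_shift[OF X] by blast
    with step.IH show ?case by (rule trancl_into_trancl)
  qed
  show ?thesis
    unfolding translation_invariant_def
  proof (intro allI iffI)
    fix a b assume "(a, b) \<in> (\<Union>X)\<^sup>+"
    then show "(a + int n, b + int n) \<in> (\<Union>X)\<^sup>+" using shift[of a b 1] by simp
  next
    fix a b assume "(a + int n, b + int n) \<in> (\<Union>X)\<^sup>+"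
    then show "(a, b) \<in> (\<Union>X)\<^sup>+" using shift[of "a + int n" "b + int n" "- 1"] by simp
  qed
qed


section \<open>Bracket relations\<close>

definition bracket :: "nat \<Rightarrow> int rel \<Rightarrow> bool" where
  "bracket n J \<longleftrightarrow>
     (\<forall>(a, b)\<in>J. a < b) \<and> translation_invariant n J \<and> trans J \<and>
     (\<forall>a b c. (a, c) \<in> J \<longrightarrow> a < b \<longrightarrow> b < c \<longrightarrow> (a, b) \<in> J)"

lemma bracket_less: "bracket n J \<Longrightarrow> (a, b) \<in> J \<Longrightarrow> a < b"
  by (auto simp: bracket_def)

lemma bracket_invariant: "bracket n J \<Longrightarrow> translation_invariant n J"
  by (simp add: bracket_def)

lemma bracket_trans: "bracket n J \<Longrightarrow> (a, b) \<in> J \<Longrightarrow> (b, c) \<in> J \<Longrightarrow> (a, c) \<in> J"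
  unfolding bracket_def by (blast dest: transD)

lemma bracket_shrink: "bracket n J \<Longrightarrow> (a, c) \<in> J \<Longrightarrow> a < b \<Longrightarrow> b \<le> c \<Longrightarrow> (a, b) \<in> J"
  unfolding bracket_def by (cases "b = c") (simp, metis order_le_less)

lemmas bracket_shift = translation_invariant_shift[OF bracket_invariant]

text \<open>
  Chaining translates of \<open>(a, a + n)\<close> reaches arbitrarily far: in terms of bracket vectors, a
  value of at least \<open>a + n\<close> at \<open>a\<close> is infinite.
\<close>

lemma bracket_waning:
  assumes J: "bracket n J" and a: "(a, a + int n) \<in> J" and "a < b"
  shows "(a, b) \<in> J"
proof -
  have pos: "n > 0" using bracket_less[OF J a] by simp
  have mult: "(a, a + int (Suc k) * int n) \<in> J" for k
  proof (induction k)
    case (Suc k)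
    have "(a + int (Suc k) * int n, a + int n + int (Suc k) * int n) \<in> J"
      using a bracket_shift[OF J] by blast
    with Suc have "(a, a + int n + int (Suc k) * int n) \<in> J" by (rule bracket_trans[OF J])
    then show ?case by (simp add: algebra_simps)
  qed (use a in simp)
  define k where "k = Suc (nat (b - a))"
  have "int k * 1 \<le> int k * int n"
    using pos by (intro mult_left_mono) auto
  moreover have "b - a \<le> int k" by (simp add: k_def)
  ultimately have "b \<le> a + int k * int n" by linarith
  moreover have "(a, a + int k * int n) \<in> J" unfolding k_def by (rule mult)
  ultimately show ?thesis using \<open>a < b\<close> bracket_shrink[OF J] by blast
qed

lemma bracket_Inter:
  assumes "X \<noteq> {}" and "\<And>J. J \<in> X \<Longrightarrow> bracket n J"
  shows "bracket n (\<Inter>X)"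
proof -
  have "translation_invariant n (\<Inter>X)"
    using assms(2) by (intro translation_invariant_Inter) (auto simp: bracket_def)
  moreover have "trans (\<Inter>X)"
    using assms(2) by (auto intro!: transI dest: bracket_trans)
  moreover have "\<forall>(a, b)\<in>\<Inter>X. a < b"
    using assms bracket_less by blast
  moreover have "(a, b) \<in> \<Inter>X" if "(a, c) \<in> \<Inter>X" "a < b" "b < c" for a b c
    using that assms(2) bracket_shrink by (meson InterE InterI less_imp_le)
  ultimately show ?thesis
    unfolding bracket_def by blast
qed

lemma bracket_Int:
  assumes "bracket n J" and "bracket n K"
  shows "bracket n (J \<inter> K)"
proof -
  have "bracket n (\<Inter>{J, K})"
    by (rule bracket_Inter) (use assms in blast)+
  then show ?thesis by simp
qed

definition bracket_join :: "int rel set \<Rightarrow> int rel" where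
  "bracket_join X = (\<Union>X)\<^sup>+"

text \<open>
  The closure property survives transitive closure: if \<open>b\<close> falls inside one link of a chain
  from \<open>a\<close> to \<open>c\<close>, that link can be shortened to end at \<open>b\<close>, and the rest of the chain dropped.
\<close>

lemma bracket_bracket_join:
  assumes X: "\<And>J. J \<in> X \<Longrightarrow> bracket n J"
  shows "bracket n (bracket_join X)"
proof -
  have less_step: "a < b" if "(a, b) \<in> \<Union>X" for a b
  proof -
    from that obtain J where J: "J \<in> X" "(a, b) \<in> J" by (rule UnionE)
    show ?thesis by (rule bracket_less[OF X[OF J(1)] J(2)])
  qed
  have shrink_step: "(a, b) \<in> \<Union>X" if ac: "(a, c) \<in> \<Union>X" and "a < b" "b \<le> c" for a b c
  proof -
    from ac obtain J where J: "J \<in> X" "(a, c) \<in> J" by (rule UnionE)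
    have "(a, b) \<in> J" by (rule bracket_shrink[OF X[OF J(1)] J(2) that(2,3)])
    with J(1) show ?thesis by (rule UnionI)
  qed
  have less: "a < b" if "(a, b) \<in> (\<Union>X)\<^sup>+" for a b
    using that
  proof (induction rule: trancl_induct)
    case (base b)
    then show ?case by (rule less_step)
  next
    case (step b c)
    from less_step[OF step.hyps(2)] step.IH show ?case by simp
  qed
  have shrink: "(a, b) \<in> (\<Union>X)\<^sup>+" if "(a, c) \<in> (\<Union>X)\<^sup>+" "a < b" "b \<le> c" for a b c
    using that
  proof (induction arbitrary: b rule: trancl_induct)
    case (base c)
    then have "(a, b) \<in> \<Union>X" by (rule shrink_step)
    then show ?case by (rule r_into_trancl)
  next
    case (step c d)
    show ?case
    proof (cases "b \<le> c")
      case True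
      with step.prems(1) show ?thesis by (rule step.IH)
    next
      case False
      then have "(c, b) \<in> \<Union>X"
        using shrink_step[OF step.hyps(2) _ step.prems(2)] by simp
      with step.hyps(1) show ?thesis by (rule trancl_into_trancl)
    qed
  qed
  have "translation_invariant n ((\<Union>X)\<^sup>+)"
    by (rule translation_invariant_trancl_Union) (rule bracket_invariant[OF X])
  moreover have "\<forall>(a, b)\<in>(\<Union>X)\<^sup>+. a < b"
    using less by blast
  moreover have "(a, b) \<in> (\<Union>X)\<^sup>+" if "(a, c) \<in> (\<Union>X)\<^sup>+" "a < b" "b < c" for a b c
    using shrink[OF that(1,2)] that(3) by simp
  ultimately show ?thesis
    unfolding bracket_def bracket_join_def by (simp add: split_beta)
qed

lemma bracket_join_upper: "J \<in> X \<Longrightarrow> J \<subseteq> bracket_join X"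
  by (auto simp: bracket_join_def)

lemma bracket_join_least:
  assumes "bracket n K" and "\<And>J. J \<in> X \<Longrightarrow> J \<subseteq> K"
  shows "bracket_join X \<subseteq> K"
proof -
  have "K\<^sup>+ = K" using assms(1) by (simp add: bracket_def trancl_id)
  moreover have "\<Union>X \<subseteq> K" using assms(2) by blast
  ultimately show ?thesis
    unfolding bracket_join_def by (metis trancl_mono subsetI)
qed

lemma bracket_join_absorb:
  assumes "bracket n K" and "J \<subseteq> K"
  shows "bracket_join {K, J} = K"
  using assms bracket_join_least[of n K "{K, J}"] bracket_join_upper[of K "{K, J}"] by blast

text \<open>
  Induction along a chain in \<open>\<Union>Z\<close> from \<open>a\<close> to \<open>c\<close> with \<open>(a, c) \<in> y\<close>. Every intermediate \<open>b\<close>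
  satisfies \<open>(a, b) \<in> y\<close>, so \<open>(a, b) \<in> x\<close>. As \<open>x\<close> lies below every \<open>z \<in> Z\<close>, the pair \<open>(a, b)\<close>
  can be composed with the next link inside the one \<open>z\<close> to which that link belongs.
\<close>

lemma bracket_meet_semidistributive:
  assumes Z: "\<And>z. z \<in> Z \<Longrightarrow> bracket n z" and "Z \<noteq> {}" and y: "bracket n y"
    and eq: "\<And>z. z \<in> Z \<Longrightarrow> z \<inter> y = x"
  shows "bracket_join Z \<inter> y = x"
proof
  have "(a, b) \<in> x" if "(a, b) \<in> (\<Union>Z)\<^sup>+" "(a, b) \<in> y" for a b
    using that
  proof (induction rule: trancl_induct)
    case (base b)
    then show ?case using eq by blast
  next
    case (step b c)
    then obtain z where z: "z \<in> Z" "(b, c) \<in> z" by blast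
    have "bracket n (bracket_join Z)" by (rule bracket_bracket_join[OF Z])
    then have "a < b"
      using step.hyps(1) by (auto simp: bracket_join_def dest: bracket_less)
    then have "(a, b) \<in> y"
      using bracket_shrink[OF y step.prems] bracket_less[OF Z[OF z(1)] z(2)] by simp
    then have "(a, b) \<in> z" using step.IH eq[OF z(1)] by blast
    then have "(a, c) \<in> z" using bracket_trans[OF Z[OF z(1)]] z(2) by blast
    then show ?case using step.prems eq[OF z(1)] by blast
  qed
  then show "bracket_join Z \<inter> y \<subseteq> x" by (auto simp: bracket_join_def)
  show "x \<subseteq> bracket_join Z \<inter> y"
    using \<open>Z \<noteq> {}\<close> eq bracket_join_upper by blast
qed

text \<open>
  Take \<open>(a, b) \<in> x\<close>. If some \<open>z \<union> y\<close> misses it, a chain in \<open>z \<union> y\<close> from \<open>a\<close> to \<open>b\<close> has an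
  intermediate point, which splits \<open>(a, b)\<close> into two shorter pairs of \<open>x\<close>. Otherwise \<open>(a, b)\<close>
  lies in \<open>y\<close> or in all of \<open>Z\<close>.
\<close>

lemma bracket_join_semidistributive:
  assumes Z: "\<And>z. z \<in> Z \<Longrightarrow> bracket n z" and "Z \<noteq> {}" and y: "bracket n y"
    and x: "bracket n x" and eq: "\<And>z. z \<in> Z \<Longrightarrow> bracket_join {z, y} = x"
  shows "bracket_join {\<Inter>Z, y} = x"
proof
  have below: "z \<subseteq> x" "y \<subseteq> x" if "z \<in> Z" for z
    using eq[OF that] bracket_join_upper by blast+
  then show "bracket_join {\<Inter>Z, y} \<subseteq> x"
    using \<open>Z \<noteq> {}\<close> by (intro bracket_join_least[OF x]) blast
  have "(a, b) \<in> (\<Union>{\<Inter>Z, y})\<^sup>+" if "(a, b) \<in> x" for a b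
    using that
  proof (induction "nat (b - a)" arbitrary: a b rule: less_induct)
    case less
    show ?case
    proof (cases "\<forall>z\<in>Z. (a, b) \<in> z \<union> y")
      case True
      then show ?thesis by (auto intro!: r_into_trancl)
    next
      case False
      then obtain z where z: "z \<in> Z" "(a, b) \<notin> z \<union> y" by blast
      have "(a, b) \<in> (z \<union> y)\<^sup>+"
        using less.prems eq[OF z(1)] by (simp add: bracket_join_def)
      then obtain c where c: "(a, c) \<in> (z \<union> y)\<^sup>+" "(c, b) \<in> z \<union> y"
        using z(2) by (meson tranclE)
      then have "(a, c) \<in> x" "(c, b) \<in> x"
        using eq[OF z(1)] below[OF z(1)] by (auto simp: bracket_join_def)
      moreover from this have "a < c" "c < b" using bracket_less[OF x] by auto
      ultimately show ?thesis
        using less.hyps[of c a] less.hyps[of b c] by (auto intro: trancl_trans)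
    qed
  qed
  then show "x \<subseteq> bracket_join {\<Inter>Z, y}" by (auto simp: bracket_join_def)
qed

text \<open>
  By translation only pairs starting in one period matter, and by \<open>bracket_waning\<close> the pairs of
  length at most \<open>n\<close> determine the longer ones.
\<close>

lemma finite_brackets:
  assumes "n > 0"
  shows "finite {J. bracket n J}"
proof -
  define S where "S = {0..<int n} \<times> {0..2 * int n}"
  have incl: "J \<subseteq> K" if J: "bracket n J" and K: "bracket n K" and eq: "J \<inter> S = K \<inter> S" for J K
  proof
    fix p assume "p \<in> J"
    then obtain a b where p: "p = (a, b)" and ab: "(a, b) \<in> J" by (cases p) auto
    define k where "k = a div int n"
    have a: "a + (- k) * int n = a mod int n"
      by (simp add: k_def minus_div_mult_eq_mod [symmetric])
    have near: "(a, c) \<in> K" if "(a, c) \<in> J" "c \<le> a + int n" for c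
    proof -
      have "(a + (- k) * int n, c + (- k) * int n) \<in> J"
        using that(1) bracket_shift[OF J] by blast
      moreover have "a mod int n < int n" "0 \<le> a mod int n" using assms by auto
      moreover have "a < c" using bracket_less[OF J that(1)] .
      ultimately have "(a + (- k) * int n, c + (- k) * int n) \<in> J \<inter> S"
        unfolding S_def using a that(2) by (simp, linarith)
      then have "(a + (- k) * int n, c + (- k) * int n) \<in> K" using eq by blast
      then show ?thesis using bracket_shift[OF K] by blast
    qed
    show "p \<in> K"
    proof (cases "b \<le> a + int n")
      case False
      then have "(a, a + int n) \<in> K"
        using near bracket_shrink[OF J ab] assms by auto
      then show ?thesis
        using bracket_waning[OF K] bracket_less[OF J ab] p by blast
    qed (use near ab p in auto)
  qed
  have "inj_on (\<lambda>J. J \<inter> S) {J. bracket n J}"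
    using incl by (intro inj_onI) blast
  moreover have "(\<lambda>J. J \<inter> S) ` {J. bracket n J} \<subseteq> Pow S" by auto
  moreover have "finite (Pow S)" by (simp add: S_def)
  ultimately show ?thesis by (meson finite_imageD finite_subset)
qed


section \<open>Passing from TITOs to bracket relations\<close>

definition inverted_pairs :: "int rel \<Rightarrow> int rel" where
  "inverted_pairs r = {(a, b). a < b \<and> (b, a) \<in> r}"

definition order_of_brackets :: "int rel \<Rightarrow> int rel" where
  "order_of_brackets J = {(a, b). (a \<le> b \<and> (a, b) \<notin> J) \<or> (b, a) \<in> J}"

lemma tito_iff: "tito n r \<longleftrightarrow> linear_order_on UNIV r \<and> translation_invariant n r"
  by (simp add: tito_def translation_invariant_def)

lemma tito_refl: "tito n r \<Longrightarrow> (a, a) \<in> r"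
  and tito_antisym: "tito n r \<Longrightarrow> (a, b) \<in> r \<Longrightarrow> (b, a) \<in> r \<Longrightarrow> a = b"
  and tito_trans: "tito n r \<Longrightarrow> (a, b) \<in> r \<Longrightarrow> (b, c) \<in> r \<Longrightarrow> (a, c) \<in> r"
  by (auto simp: tito_iff linear_order_on_def partial_order_on_def preorder_on_def refl_on_def
      dest: antisymD transD)

lemma tito_total: "tito n r \<Longrightarrow> (a, b) \<in> r \<or> (b, a) \<in> r"
  using tito_refl[of n r a]
  by (cases "a = b") (auto simp: tito_iff linear_order_on_def total_on_def)

lemma tito_mem_iff:
  assumes "tito n r"
  shows "(a, b) \<in> r \<longleftrightarrow> (a \<le> b \<and> (a, b) \<notin> inverted_pairs r) \<or> (b, a) \<in> inverted_pairs r"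
  using tito_refl[OF assms, of a] tito_antisym[OF assms, of a b] tito_total[OF assms, of a b]
  by (auto simp: inverted_pairs_def)

lemma order_of_inverted_pairs: "tito n r \<Longrightarrow> order_of_brackets (inverted_pairs r) = r"
  using tito_mem_iff by (auto simp: order_of_brackets_def)

lemma bracket_inverted_pairs:
  assumes r: "tito n r" and av: "avoids_312 r"
  shows "bracket n (inverted_pairs r)"
proof -
  have inv: "translation_invariant n r" using r by (simp add: tito_iff)
  have "translation_invariant n (inverted_pairs r)"
    unfolding translation_invariant_def inverted_pairs_def
    using translation_invariantD[OF inv] by auto
  moreover have "trans (inverted_pairs r)"
    by (rule transI) (auto simp: inverted_pairs_def intro: tito_trans[OF r])
  moreover have "(a, b) \<in> inverted_pairs r"
    if "(a, c) \<in> inverted_pairs r" "a < b" "b < c" for a b c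
    using that av tito_total[OF r, of a b] by (auto simp: inverted_pairs_def avoids_312_def)
  ultimately show ?thesis by (auto simp: bracket_def inverted_pairs_def)
qed

lemma inverted_pairs_order:
  assumes "bracket n J"
  shows "inverted_pairs (order_of_brackets J) = J"
  using bracket_less[OF assms] by (force simp: inverted_pairs_def order_of_brackets_def)

text \<open>
  Transitivity needs the complement of \<open>J\<close> to be transitive as well, which is where the closure
  property enters: a pair \<open>(a, c) \<in> J\<close> with \<open>a < b < c\<close> already has \<open>(a, b) \<in> J\<close>.
\<close>

lemma tito_order_of_brackets:
  assumes J: "bracket n J"
  shows "tito n (order_of_brackets J)"
proof -
  note lt = bracket_less[OF J] and tr = bracket_trans[OF J] and sh = bracket_shrink[OF J]
  have "trans (order_of_brackets J)"
  proof (rule transI)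
    fix a b c
    assume "(a, b) \<in> order_of_brackets J" "(b, c) \<in> order_of_brackets J"
    then consider (1) "a \<le> b" "(a, b) \<notin> J" "b \<le> c" "(b, c) \<notin> J"
      | (2) "a \<le> b" "(a, b) \<notin> J" "(c, b) \<in> J"
      | (3) "(b, a) \<in> J" "b \<le> c" "(b, c) \<notin> J"
      | (4) "(b, a) \<in> J" "(c, b) \<in> J"
      by (auto simp: order_of_brackets_def)
    then show "(a, c) \<in> order_of_brackets J"
    proof cases
      case 1
      then show ?thesis
        using sh[of a c b] by (cases "a = b") (auto simp: order_of_brackets_def)
    next
      case 2
      then have "c < b" using lt by blast
      with 2 show ?thesis
        using sh[of c b a] tr[of a c b] by (cases "a \<le> c") (auto simp: order_of_brackets_def)
    next
      case 3
      show ?thesis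
      proof (cases "b = c")
        case True
        with 3 show ?thesis by (simp add: order_of_brackets_def)
      next
        case False
        with 3 have "\<not> c \<le> a" using sh[of b a c] by auto
        moreover have "(a, c) \<notin> J" using 3 tr by blast
        ultimately show ?thesis by (simp add: order_of_brackets_def)
      qed
    next
      case 4
      then show ?thesis using tr by (auto simp: order_of_brackets_def)
    qed
  qed
  moreover have "refl (order_of_brackets J)"
    using lt by (fastforce simp: refl_on_def order_of_brackets_def)
  moreover have "antisym (order_of_brackets J)"
    by (rule antisymI) (auto simp: order_of_brackets_def dest: lt less_asym)
  moreover have "total (order_of_brackets J)"
    by (auto simp: total_on_def order_of_brackets_def)
  moreover have "translation_invariant n (order_of_brackets J)"
    unfolding translation_invariant_def order_of_brackets_def
    using translation_invariantD[OF bracket_invariant[OF J]] by auto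
  ultimately show ?thesis
    by (simp add: tito_iff linear_order_on_def partial_order_on_def preorder_on_def)
qed

lemma avoids_312_order_of_brackets:
  assumes J: "bracket n J"
  shows "avoids_312 (order_of_brackets J)"
  unfolding avoids_312_def
proof clarify
  fix a b c
  assume "a < b" "b < c" "(c, a) \<in> order_of_brackets J" "(a, b) \<in> order_of_brackets J"
  then have "(a, c) \<in> J" "(a, b) \<notin> J"
    using bracket_less[OF J] by (auto simp: order_of_brackets_def dest: less_asym)
  then show False
    using bracket_shrink[OF J] \<open>a < b\<close> \<open>b < c\<close> by fastforce
qed

lemma inversions_subset_iff:
  assumes r: "tito n r" and s: "tito n s"
  shows "inversions n r \<subseteq> inversions n s \<longleftrightarrow> inverted_pairs r \<subseteq> inverted_pairs s"
proof -
  have mem: "translation_equiv n `` {(a, b)} \<in> inversions n q \<longleftrightarrow> (a, b) \<in> inverted_pairs q"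
    if "a < b" "tito n q" for a b q
  proof -
    have inv: "translation_invariant n q" using that(2) by (simp add: tito_iff)
    have "translation_equiv n `` {(a, b)} \<in> reflection_indices n"
      using that(1) by (auto simp: reflection_indices_def intro: quotientI)
    moreover have "translation_equiv n `` {(a, b)}
        = {(a + k * int n, b + k * int n) | k. True}"
      using that(1) by (auto simp: translation_equiv_def)
    ultimately show ?thesis
      using that(1) translation_invariant_shift[OF inv]
      by (auto simp: inversions_def inverted_pairs_def)
        (metis (no_types, lifting) add_0_right mult_zero_left of_int_0)
  qed
  have rep: "\<exists>a b. a < b \<and> t = translation_equiv n `` {(a, b)}" if "t \<in> inversions n q" for t q
    using that by (auto simp: inversions_def reflection_indices_def elim!: quotientE)
  show ?thesis
  proof
    assume "inversions n r \<subseteq> inversions n s"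
    then show "inverted_pairs r \<subseteq> inverted_pairs s"
      using mem[OF _ r] mem[OF _ s] by (fastforce simp: inverted_pairs_def)
  next
    assume sub: "inverted_pairs r \<subseteq> inverted_pairs s"
    show "inversions n r \<subseteq> inversions n s"
    proof
      fix t assume t: "t \<in> inversions n r"
      then obtain a b where "a < b" "t = translation_equiv n `` {(a, b)}" using rep by blast
      with t sub show "t \<in> inversions n s" using mem r s by blast
    qed
  qed
qed


section \<open>A criterion for semidistributivity\<close>

lemma is_glbI:
  fixes L (structure)
  assumes "z \<in> carrier L" "y \<in> carrier L" "g \<in> carrier L" "g \<sqsubseteq> z" "g \<sqsubseteq> y"
    and "\<And>w. w \<in> carrier L \<Longrightarrow> w \<sqsubseteq> z \<Longrightarrow> w \<sqsubseteq> y \<Longrightarrow> w \<sqsubseteq> g"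
  shows "is_glb L g {z, y}"
  using assms by (auto simp: greatest_def Lower_def)

lemma is_lubI:
  fixes L (structure)
  assumes "z \<in> carrier L" "y \<in> carrier L" "g \<in> carrier L" "z \<sqsubseteq> g" "y \<sqsubseteq> g"
    and "\<And>w. w \<in> carrier L \<Longrightarrow> z \<sqsubseteq> w \<Longrightarrow> y \<sqsubseteq> w \<Longrightarrow> g \<sqsubseteq> w"
  shows "is_lub L g {z, y}"
  using assms by (auto simp: least_def Upper_def)

text \<open>
  The meet in the definition of semidistributivity is chosen by Hilbert's operator, so it is
  identified here with an explicitly given greatest lower bound \<open>m\<close>. Applied to the dual order,
  the criterion gives join-semidistributivity.
\<close>

lemma meet_semidistributiveI:
  fixes L (structure)
  assumes "partial_order L"
    and glb: "\<And>z y. z \<in> carrier L \<Longrightarrow> y \<in> carrier L \<Longrightarrow> is_glb L (m z y) {z, y}"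
    and greatest: "\<And>Z x y. Z \<subseteq> carrier L \<Longrightarrow> Z \<noteq> {} \<Longrightarrow> y \<in> carrier L \<Longrightarrow> x \<in> carrier L \<Longrightarrow>
      (\<And>z. z \<in> Z \<Longrightarrow> m z y = x) \<Longrightarrow> \<exists>g\<in>carrier L. m g y = x \<and> (\<forall>z\<in>Z. z \<sqsubseteq> g)"
  shows "meet_semidistributive L"
proof -
  interpret partial_order L by fact
  have meet: "z \<sqinter> y = m z y" if "z \<in> carrier L" "y \<in> carrier L" for z y
    unfolding meet_def inf_def
    using glb[OF that] greatest_unique by (blast intro: some_equality)
  show ?thesis
    unfolding meet_semidistributive_def
  proof (intro ballI impI)
    fix x y
    assume x: "x \<in> carrier L" and y: "y \<in> carrier L"
      and ne: "{z \<in> carrier L. z \<sqinter> y = x} \<noteq> {}"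
    have "\<exists>g\<in>carrier L. m g y = x \<and> (\<forall>z\<in>{z \<in> carrier L. z \<sqinter> y = x}. z \<sqsubseteq> g)"
      by (rule greatest) (use x y ne meet in auto)
    then show "\<exists>g. Order.greatest L g {z \<in> carrier L. z \<sqinter> y = x}"
      using meet y by (auto simp: greatest_def)
  qed
qed


section \<open>Coreflective join-quotients\<close>

text \<open>
  For such an \<open>R\<close> the relations fixed by \<open>R\<close> are closed under joins, their meet is \<open>R (J \<inter> K)\<close>,
  and \<open>R\<close> is a lattice homomorphism onto them.
\<close>

locale bracket_coreflection =
  fixes n :: nat and R :: "int rel \<Rightarrow> int rel"
  assumes n_pos: "n > 0"
    and bracket_R: "bracket n J \<Longrightarrow> bracket n (R J)"
    and R_subset: "bracket n J \<Longrightarrow> R J \<subseteq> J"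
    and R_mono: "bracket n J \<Longrightarrow> bracket n K \<Longrightarrow> J \<subseteq> K \<Longrightarrow> R J \<subseteq> R K"
    and R_idem: "bracket n J \<Longrightarrow> R (R J) = R J"
    and R_join: "(\<And>J. J \<in> X \<Longrightarrow> bracket n J) \<Longrightarrow> R (bracket_join X) = bracket_join (R ` X)"
begin

definition fixed :: "int rel set" where
  "fixed = {J. bracket n J \<and> R J = J}"

lemma fixed_bracket: "J \<in> fixed \<Longrightarrow> bracket n J"
  and fixed_eq: "J \<in> fixed \<Longrightarrow> R J = J"
  by (simp_all add: fixed_def)

lemma R_in_fixed: "bracket n J \<Longrightarrow> R J \<in> fixed"
  by (simp add: fixed_def bracket_R R_idem)

lemma join_in_fixed:
  assumes "X \<subseteq> fixed"
  shows "bracket_join X \<in> fixed"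
proof -
  have fixed: "J \<in> fixed" if "J \<in> X" for J using that assms by blast
  have br: "bracket n J" if "J \<in> X" for J by (rule fixed_bracket[OF fixed[OF that]])
  have "R ` X = X" using fixed_eq[OF fixed] by simp
  then have "R (bracket_join X) = bracket_join X" using R_join[OF br] by simp
  then show ?thesis
    unfolding fixed_def using bracket_bracket_join[OF br] by simp
qed

lemma R_Int:
  assumes J: "bracket n J" and K: "bracket n K"
  shows "R (R J \<inter> R K) = R (J \<inter> K)"
proof
  note JK = bracket_Int[OF J K] and RR = bracket_Int[OF bracket_R[OF J] bracket_R[OF K]]
  show "R (R J \<inter> R K) \<subseteq> R (J \<inter> K)"
    using R_subset J K by (intro R_mono RR JK) blast
  have "R (J \<inter> K) \<subseteq> R J \<inter> R K"
    using R_mono[OF JK J] R_mono[OF JK K] by blast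
  then have "R (R (J \<inter> K)) \<subseteq> R (R J \<inter> R K)"
    by (intro R_mono RR bracket_R JK)
  then show "R (J \<inter> K) \<subseteq> R (R J \<inter> R K)"
    using R_idem[OF JK] by simp
qed

text \<open>
  The fixed relations have the same joins as all bracket relations, so
  \<open>bracket_join_semidistributive\<close> applies unchanged to \<open>\<Inter>Z\<close>, and applying \<open>R\<close> to its conclusion
  replaces \<open>\<Inter>Z\<close> by the meet of \<open>Z\<close> among the fixed relations.
\<close>

lemma fixed_join_semidistributive:
  assumes Z: "Z \<subseteq> fixed" "Z \<noteq> {}" and y: "y \<in> fixed" and x: "x \<in> fixed"
    and eq: "\<And>z. z \<in> Z \<Longrightarrow> bracket_join {z, y} = x"
  shows "bracket_join {R (\<Inter>Z), y} = x"
proof -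
  have brZ: "bracket n z" if "z \<in> Z" for z using that Z(1) fixed_bracket by blast
  have "bracket_join {\<Inter>Z, y} = x"
    by (rule bracket_join_semidistributive[OF brZ Z(2) fixed_bracket[OF y] fixed_bracket[OF x] eq])
  moreover have "R (bracket_join {\<Inter>Z, y}) = bracket_join (R ` {\<Inter>Z, y})"
    by (rule R_join) (use bracket_Inter[OF Z(2) brZ] fixed_bracket[OF y] in blast)
  ultimately show ?thesis
    using fixed_eq[OF x] fixed_eq[OF y] by simp
qed

text \<open>
  The equation \<open>R (z \<inter> y) = x\<close> only says that \<open>z \<inter> y\<close> lies in the fibre of \<open>R\<close> over \<open>x\<close>. Since
  \<open>R\<close> preserves joins, this fibre has a largest element \<open>u\<close>. Joining \<open>u\<close> to all \<open>z\<close> and to \<open>y\<close>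
  does not change their images under \<open>R\<close>, but makes the intersection equal to \<open>u\<close>, so that
  \<open>bracket_meet_semidistributive\<close> applies to the enlarged relations.
\<close>

lemma fixed_meet_semidistributive:
  assumes Z: "Z \<subseteq> fixed" "Z \<noteq> {}" and y: "y \<in> fixed" and x: "x \<in> fixed"
    and eq: "\<And>z. z \<in> Z \<Longrightarrow> R (z \<inter> y) = x"
  shows "R (bracket_join Z \<inter> y) = x"
proof -
  define fibre where "fibre = {J. bracket n J \<and> R J = x}"
  define u where "u = bracket_join fibre"
  have u: "bracket n u"
    unfolding u_def by (rule bracket_bracket_join) (simp add: fibre_def)
  have "x \<in> fibre" using x by (simp add: fibre_def fixed_def)
  then have "R ` fibre = {x}" by (auto simp: fibre_def)
  then have "R u = bracket_join {x}"
    unfolding u_def using R_join[of fibre] by (simp add: fibre_def)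
  then have Ru: "R u = x"
    using bracket_join_absorb[OF fixed_bracket[OF x] subset_refl] by simp
  have u_max: "J \<subseteq> u" if "bracket n J" "R J = x" for J
    unfolding u_def using that by (intro bracket_join_upper) (simp add: fibre_def)
  define up where "up = (\<lambda>z. bracket_join {z, u})"
  have up: "bracket n (up z)" "u \<subseteq> up z" "z \<subseteq> up z" if "bracket n z" for z
    unfolding up_def using that u bracket_bracket_join[of "{z, u}" n] bracket_join_upper[of _ "{z, u}"]
    by auto
  have R_up: "R (up z) = z" if "z \<in> fixed" "x \<subseteq> z" for z
  proof -
    have "R (up z) = bracket_join (R ` {z, u})"
      unfolding up_def by (rule R_join) (use u fixed_bracket[OF that(1)] in blast)
    then show ?thesis
      using that fixed_eq[OF that(1)] Ru bracket_join_absorb[OF fixed_bracket[OF that(1)] that(2)]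
      by simp
  qed
  have z: "bracket n z" "x \<subseteq> z" "x \<subseteq> y" if "z \<in> Z" for z
  proof -
    show "bracket n z" using that Z(1) fixed_bracket by blast
    then have "x \<subseteq> z \<inter> y"
      using eq[OF that] R_subset[OF bracket_Int[OF _ fixed_bracket[OF y]]] by blast
    then show "x \<subseteq> z" "x \<subseteq> y" by auto
  qed
  then have xy: "x \<subseteq> y" using Z(2) by blast
  have upy: "bracket n (up y)" "u \<subseteq> up y" "R (up y) = y"
    using up fixed_bracket[OF y] R_up[OF y xy] by auto
  have meet_up: "up z \<inter> up y = u" if "z \<in> Z" for z
  proof
    have "R (up z \<inter> up y) = R (R (up z) \<inter> R (up y))"
      using R_Int[OF up(1)[OF z(1)[OF that]] upy(1)] by simp
    also have "\<dots> = x"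
      using R_up[of z] that Z(1) z(2)[OF that] upy(3) eq[OF that] by auto
    \<comment> \<open>The intersection lies in the fibre over \<open>x\<close>, hence below its largest element.\<close>
    finally show "up z \<inter> up y \<subseteq> u"
      by (intro u_max bracket_Int up(1)[OF z(1)[OF that]] upy(1))
    show "u \<subseteq> up z \<inter> up y"
      using up(2)[OF z(1)[OF that]] upy(2) by blast
  qed
  have brs: "bracket n w" if "w \<in> up ` Z" for w
    using that up(1) z(1) by blast
  have joins: "bracket_join (up ` Z) \<inter> up y = u"
    by (rule bracket_meet_semidistributive[OF brs _ upy(1)]) (use Z(2) meet_up in auto)
  have "R (up w) = w" if "w \<in> Z" for w
    using R_up[of w] z(2)[OF that] Z(1) that by blast
  then have "R ` up ` Z = Z" by (simp add: image_image)
  then have "R (bracket_join (up ` Z)) = bracket_join Z"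
    using R_join[OF brs] by simp
  then have "R (bracket_join Z \<inter> y) = R (bracket_join (up ` Z) \<inter> up y)"
    using R_Int[OF bracket_bracket_join[of "up ` Z", OF brs] upy(1)] upy(3) by simp
  also have "\<dots> = x" using joins Ru by simp
  finally show ?thesis .
qed

lemma semidistributive_inversion_order:
  assumes C: "C = {r. tito n r \<and> avoids_312 r \<and> R (inverted_pairs r) = inverted_pairs r}"
  shows "finite_lattice (inversion_order n C) \<and> semidistributive (inversion_order n C)"
proof -
  define L where "L = inversion_order n C"
  have L [simp]: "carrier L = C" "eq L = (=)"
    and L_le: "le L r s \<longleftrightarrow> inversions n r \<subseteq> inversions n s" for r s
    by (simp_all only: L_def inversion_order_def partial_object.simps eq_object.simps gorder.simps)
  define \<phi> where "\<phi> = inverted_pairs"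
  define \<psi> where "\<psi> = order_of_brackets"
  have le: "le L r s \<longleftrightarrow> \<phi> r \<subseteq> \<phi> s" if "r \<in> C" "s \<in> C" for r s
  proof -
    have "tito n r" "tito n s" using that by (simp_all add: C)
    then show ?thesis unfolding L_le \<phi>_def by (rule inversions_subset_iff)
  qed
  have \<phi>: "\<phi> r \<in> fixed" "\<psi> (\<phi> r) = r" if "r \<in> C" for r
  proof -
    have r: "tito n r" "avoids_312 r" "R (\<phi> r) = \<phi> r" using that by (auto simp: C \<phi>_def)
    show "\<phi> r \<in> fixed"
      using bracket_inverted_pairs[OF r(1,2)] r(3) by (simp add: fixed_def \<phi>_def)
    show "\<psi> (\<phi> r) = r"
      unfolding \<phi>_def \<psi>_def by (rule order_of_inverted_pairs[OF r(1)])
  qed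
  have \<psi>: "\<psi> J \<in> C" "\<phi> (\<psi> J) = J" if "J \<in> fixed" for J
  proof -
    note J = fixed_bracket[OF that]
    show eq: "\<phi> (\<psi> J) = J"
      unfolding \<phi>_def \<psi>_def by (rule inverted_pairs_order[OF J])
    show "\<psi> J \<in> C"
      using tito_order_of_brackets[OF J] avoids_312_order_of_brackets[OF J] eq fixed_eq[OF that]
      by (simp add: C \<phi>_def \<psi>_def)
  qed
  have po: "partial_order L"
  proof unfold_locales
    fix r s assume rs: "r \<in> carrier L" "s \<in> carrier L" "le L r s" "le L s r"
    then have "\<phi> r = \<phi> s" using le by auto
    then have "\<psi> (\<phi> r) = \<psi> (\<phi> s)" by simp
    then show "eq L r s" using \<phi>(2) rs by simp
  next
    fix r s t
    assume rst: "r \<in> carrier L" "s \<in> carrier L" "t \<in> carrier L" and "le L r s" "le L s t"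
    then have "\<phi> r \<subseteq> \<phi> s" "\<phi> s \<subseteq> \<phi> t" using le by simp_all
    then have "\<phi> r \<subseteq> \<phi> t" by (rule subset_trans)
    then show "le L r t" using le rst by simp
  qed (simp_all add: le)
  define m where "m = (\<lambda>r s. \<psi> (R (\<phi> r \<inter> \<phi> s)))"
  define j where "j = (\<lambda>r s. \<psi> (bracket_join {\<phi> r, \<phi> s}))"
  have m: "m r s \<in> C" "\<phi> (m r s) = R (\<phi> r \<inter> \<phi> s)" if "r \<in> C" "s \<in> C" for r s
  proof -
    have "R (\<phi> r \<inter> \<phi> s) \<in> fixed"
      by (intro R_in_fixed bracket_Int fixed_bracket \<phi>(1) that)
    then show "m r s \<in> C" "\<phi> (m r s) = R (\<phi> r \<inter> \<phi> s)"
      unfolding m_def by (rule \<psi>)+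
  qed
  have j: "j r s \<in> C" "\<phi> (j r s) = bracket_join {\<phi> r, \<phi> s}" if "r \<in> C" "s \<in> C" for r s
  proof -
    have "bracket_join {\<phi> r, \<phi> s} \<in> fixed"
      by (rule join_in_fixed) (use \<phi>(1) that in blast)
    then show "j r s \<in> C" "\<phi> (j r s) = bracket_join {\<phi> r, \<phi> s}"
      unfolding j_def by (rule \<psi>)+
  qed
  have glb: "is_glb L (m r s) {r, s}" if rs: "r \<in> C" "s \<in> C" for r s
  proof (rule is_glbI)
    note br = fixed_bracket[OF \<phi>(1)]
    have "R (\<phi> r \<inter> \<phi> s) \<subseteq> \<phi> r \<inter> \<phi> s" by (rule R_subset[OF bracket_Int[OF br br]]) fact+
    then show "le L (m r s) r" "le L (m r s) s" using le m rs by auto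
    fix w assume w: "w \<in> carrier L" "le L w r" "le L w s"
    then have "\<phi> w \<subseteq> \<phi> r \<inter> \<phi> s" using le rs by auto
    then have "R (\<phi> w) \<subseteq> R (\<phi> r \<inter> \<phi> s)" using w rs by (intro R_mono bracket_Int br) auto
    then show "le L w (m r s)" using le m rs w fixed_eq[OF \<phi>(1)] by auto
  qed (use rs m in auto)
  have lub: "is_lub L (j r s) {r, s}" if rs: "r \<in> C" "s \<in> C" for r s
  proof (rule is_lubI)
    show "le L r (j r s)" "le L s (j r s)"
      using le j rs bracket_join_upper[of _ "{\<phi> r, \<phi> s}"] by auto
    fix w assume w: "w \<in> carrier L" "le L r w" "le L s w"
    then have "bracket_join {\<phi> r, \<phi> s} \<subseteq> \<phi> w"
      using le rs by (intro bracket_join_least[OF fixed_bracket[OF \<phi>(1)]]) auto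
    then show "le L (j r s) w" using le j rs w by auto
  qed (use rs j in auto)
  interpret partial_order L by (rule po)
  have "lattice L"
    by unfold_locales (use glb lub in \<open>simp_all, blast+\<close>)
  moreover have "finite C"
  proof (rule finite_imageD)
    have "\<phi> ` C \<subseteq> {J. bracket n J}" using \<phi>(1) fixed_bracket by blast
    then show "finite (\<phi> ` C)" by (rule finite_subset[OF _ finite_brackets[OF n_pos]])
    show "inj_on \<phi> C" by (rule inj_on_inverseI[of _ \<psi>]) (rule \<phi>(2))
  qed
  moreover have "meet_semidistributive L"
  proof (rule meet_semidistributiveI[OF po, of m])
    fix Z x y
    assume Z: "Z \<subseteq> carrier L" "Z \<noteq> {}" and y: "y \<in> carrier L" and x: "x \<in> carrier L"
      and eq: "\<And>z. z \<in> Z \<Longrightarrow> m z y = x"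
    define g where "g = bracket_join (\<phi> ` Z)"
    have g: "g \<in> fixed" unfolding g_def using Z(1) \<phi>(1) by (intro join_in_fixed) auto
    have "R (g \<inter> \<phi> y) = \<phi> x"
      unfolding g_def
    proof (rule fixed_meet_semidistributive)
      fix w assume "w \<in> \<phi> ` Z"
      then obtain z where "z \<in> Z" "w = \<phi> z" by blast
      then show "R (w \<inter> \<phi> y) = \<phi> x" using eq[of z] m(2)[of z y] Z(1) y by auto
    qed (use Z x y \<phi>(1) in auto)
    then have "m (\<psi> g) y = x" using \<psi>(2)[OF g] \<phi>(2) x by (simp add: m_def)
    moreover have "le L z (\<psi> g)" if "z \<in> Z" for z
      using that le \<psi>[OF g] Z(1) bracket_join_upper[of "\<phi> z" "\<phi> ` Z"] by (auto simp: g_def)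
    ultimately show "\<exists>g\<in>carrier L. m g y = x \<and> (\<forall>z\<in>Z. le L z g)"
      using \<psi>(1)[OF g] by auto
  qed (use glb in auto)
  moreover have "join_semidistributive L"
    unfolding join_semidistributive_def
  proof (rule meet_semidistributiveI[of _ j])
    show "partial_order (inv_gorder L)" by (rule dual_order)
    fix Z x y
    assume "Z \<subseteq> carrier (inv_gorder L)" and Z2: "Z \<noteq> {}"
      and "y \<in> carrier (inv_gorder L)" and "x \<in> carrier (inv_gorder L)"
      and eq: "\<And>z. z \<in> Z \<Longrightarrow> j z y = x"
    then have Z: "Z \<subseteq> C" and y: "y \<in> C" and x: "x \<in> C" by simp_all
    define g where "g = R (\<Inter>(\<phi> ` Z))"
    have br: "bracket n w" if "w \<in> \<phi> ` Z" for w
      using that Z \<phi>(1) fixed_bracket by blast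
    have ne: "\<phi> ` Z \<noteq> {}" using Z2 by simp
    have brI: "bracket n (\<Inter>(\<phi> ` Z))" by (rule bracket_Inter[OF ne br])
    have g: "g \<in> fixed" unfolding g_def by (rule R_in_fixed[OF brI])
    have "bracket_join {g, \<phi> y} = \<phi> x"
      unfolding g_def
    proof (rule fixed_join_semidistributive)
      fix w assume "w \<in> \<phi> ` Z"
      then obtain z where "z \<in> Z" "w = \<phi> z" by blast
      then show "bracket_join {w, \<phi> y} = \<phi> x" using eq[of z] j(2)[of z y] Z y by auto
    qed (use Z Z2 x y \<phi>(1) in auto)
    then have "j (\<psi> g) y = x" using \<psi>(2)[OF g] \<phi>(2) x by (simp add: j_def)
    moreover have "le L (\<psi> g) z" if "z \<in> Z" for z
    proof -
      have "g \<subseteq> \<phi> z" unfolding g_def using R_subset[OF brI] that by blast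
      then show ?thesis using that le \<psi>[OF g] Z by auto
    qed
    ultimately show "\<exists>g\<in>carrier (inv_gorder L). j g y = x \<and> (\<forall>z\<in>Z. le (inv_gorder L) z g)"
      using \<psi>(1)[OF g] by auto
  next
    fix z y assume "z \<in> carrier (inv_gorder L)" "y \<in> carrier (inv_gorder L)"
    then have "is_lub L (j z y) {z, y}" using lub by simp
    then show "is_glb (inv_gorder L) (j z y) {z, y}"
      by (simp only: greatest_dual Lower_dual)
  qed
  ultimately show ?thesis
    unfolding finite_lattice_def semidistributive_def L_def[symmetric] L(1) by blast
qed

end


section \<open>The real part\<close>

text \<open>
  A pair of length at least \<open>n\<close> can only start in a waning class, and it is kept iff there is a
  second waning class. This form, without a case distinction on the number of waning classes, is
  visibly monotone in \<open>J\<close>.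
\<close>

definition real_part :: "nat \<Rightarrow> int rel \<Rightarrow> int rel" where
  "real_part n J = {(a, b) \<in> J.
     b < a + int n \<or> (\<exists>c. \<not> int n dvd c - a \<and> (c, c + int n) \<in> J)}"

lemma real_part_subset: "real_part n J \<subseteq> J"
  by (auto simp: real_part_def)

lemma real_part_mono: "J \<subseteq> K \<Longrightarrow> real_part n J \<subseteq> real_part n K"
  by (auto simp: real_part_def)

lemma real_part_waning:
  assumes "(a, a + int n) \<in> J" and "(c, c + int n) \<in> J" and "\<not> int n dvd c - a"
  shows "(a, a + int n) \<in> real_part n J"
  using assms by (auto simp: real_part_def)

lemma real_part_idem:
  assumes n: "n > 0" and J: "bracket n J"
  shows "real_part n (real_part n J) = real_part n J"
proof
  show "real_part n J \<subseteq> real_part n (real_part n J)"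
  proof
    fix p assume p: "p \<in> real_part n J"
    obtain a b where ab: "p = (a, b)" by (cases p)
    show "p \<in> real_part n (real_part n J)"
    proof (cases "b < a + int n")
      case False
      then obtain c where c: "\<not> int n dvd c - a" "(c, c + int n) \<in> J" and "(a, b) \<in> J"
        using p ab by (auto simp: real_part_def)
      then have "(a, a + int n) \<in> J"
        using bracket_shrink[OF J, of a b "a + int n"] False n by simp
      moreover have "\<not> int n dvd a - c"
        using c(1) by (simp add: dvd_diff_commute)
      ultimately have "(c, c + int n) \<in> real_part n J"
        using c(2) real_part_waning by blast
      then show ?thesis using p ab c(1) by (auto simp: real_part_def)
    qed (use p ab in \<open>auto simp: real_part_def\<close>)
  qed
qed (rule real_part_subset)

text \<open>
  A composite of two kept pairs may have length at least \<open>n\<close> although both are short. Then its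
  midpoint provides a second waning class, so the composite is kept.
\<close>

lemma bracket_real_part:
  assumes n: "n > 0" and J: "bracket n J"
  shows "bracket n (real_part n J)"
proof -
  note inv = translation_invariantD[OF bracket_invariant[OF J]]
  have "translation_invariant n (real_part n J)"
    unfolding translation_invariant_def
  proof (intro allI)
    fix a b
    have "int n dvd c - (a + int n) \<longleftrightarrow> int n dvd c - a" for c
    proof -
      have "c - a = (c - (a + int n)) + int n" by simp
      then show ?thesis by (metis dvd_add_triv_right_iff)
    qed
    then show "(a, b) \<in> real_part n J \<longleftrightarrow> (a + int n, b + int n) \<in> real_part n J"
      by (simp add: real_part_def inv add.commute[of "int n" a])
  qed
  moreover have "trans (real_part n J)"
  proof (rule transI)
    fix a b c
    assume ab: "(a, b) \<in> real_part n J" and bc: "(b, c) \<in> real_part n J"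
    then have J2: "(a, b) \<in> J" "(b, c) \<in> J" using real_part_subset by blast+
    have less: "a < b" "b < c" using J2 bracket_less[OF J] by auto
    have ac: "(a, c) \<in> J" by (rule bracket_trans[OF J J2])
    show "(a, c) \<in> real_part n J"
    proof (cases "c < a + int n \<or> a + int n \<le> b")
      case True
      then show ?thesis using ac ab by (auto simp: real_part_def)
    next
      case False
      \<comment> \<open>Here \<open>b\<close> lies strictly between \<open>a\<close> and \<open>a + n\<close>, so its class is the second waning class.\<close>
      then have "(b, a + int n) \<in> J"
        using bracket_shrink[OF J J2(2), of "a + int n"] by simp
      moreover have "(a + int n, b + int n) \<in> J" using J2(1) inv by simp
      ultimately have "(b, b + int n) \<in> J" by (rule bracket_trans[OF J])
      moreover have "\<not> int n dvd b - a"
        using False less zdvd_not_zless[of "b - a" "int n"] by simp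
      ultimately show ?thesis using ac by (auto simp: real_part_def)
    qed
  qed
  moreover have "\<forall>(a, b)\<in>real_part n J. a < b"
    using bracket_less[OF J] real_part_subset by blast
  moreover have "(a, b) \<in> real_part n J"
    if "(a, c) \<in> real_part n J" "a < b" "b < c" for a b c
  proof -
    have "(a, b) \<in> J"
      using that bracket_shrink[OF J, of a c b] by (auto simp: real_part_def)
    then show ?thesis using that by (auto simp: real_part_def)
  qed
  ultimately show ?thesis unfolding bracket_def by blast
qed

lemma bracket_shift_into_period:
  assumes n: "n > 0" and J: "bracket n J" and c: "(c, c + int n) \<in> J" and "\<not> int n dvd c - a"
  obtains d where "a < d" "d < a + int n" "(d, d + int n) \<in> J"
proof
  define d where "d = a + (c - a) mod int n"
  have "(c - a) mod int n \<noteq> 0" using assms(4) by (simp add: dvd_eq_mod_eq_0)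
  moreover have "0 \<le> (c - a) mod int n" "(c - a) mod int n < int n" using n by auto
  ultimately show "a < d" "d < a + int n" by (auto simp: d_def)
  have d: "d = c + (- ((c - a) div int n)) * int n"
    unfolding d_def by (simp add: minus_div_mult_eq_mod [symmetric])
  have "d + int n = (c + int n) + (- ((c - a) div int n)) * int n"
    unfolding d by (simp only: ac_simps)
  then show "(d, d + int n) \<in> J"
    using bracket_shift[OF J, of c "- ((c - a) div int n)" "c + int n"] c d by metis
qed

text \<open>
  A long pair \<open>(a, b)\<close> in the real part of the join comes with a second waning class, which
  meets the interval between \<open>a\<close> and \<open>a + n\<close> in a point \<open>d\<close>. The pairs \<open>(a, d)\<close> and
  \<open>(d, a + n)\<close> have length less than \<open>n\<close>, so chains for them use only links of length less than
  \<open>n\<close>, and taking real parts keeps those. So \<open>a\<close> is waning in the join of the real parts, too.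
\<close>

lemma real_part_join:
  assumes n: "n > 0" and X: "\<And>J. J \<in> X \<Longrightarrow> bracket n J"
  shows "real_part n (bracket_join X) = bracket_join (real_part n ` X)"
proof
  define J where "J = bracket_join X"
  define K where "K = bracket_join (real_part n ` X)"
  have J: "bracket n J" unfolding J_def by (rule bracket_bracket_join[OF X])
  have K: "bracket n K" unfolding K_def
    by (rule bracket_bracket_join) (use bracket_real_part[OF n X] in blast)
  have short: "(a, b) \<in> K" if "(a, b) \<in> J" "b < a + int n" for a b
  proof -
    have "(a, b) \<in> (\<Union>X)\<^sup>+" using that(1) by (simp add: J_def bracket_join_def)
    then show ?thesis using that(2)
    proof (induction rule: trancl_induct)
      case (base b)
      then show ?case
        unfolding K_def bracket_join_def by (intro r_into_trancl) (auto simp: real_part_def)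
    next
      case (step b c)
      from step.hyps(2) obtain I where I: "I \<in> X" "(b, c) \<in> I" by blast
      have "a < b"
        using bracket_less[OF J, of a b] step.hyps(1) by (simp add: J_def bracket_join_def)
      moreover have "b < c" by (rule bracket_less[OF X[OF I(1)] I(2)])
      ultimately have "(b, c) \<in> real_part n I" and "(a, b) \<in> K"
        using step I by (auto simp: real_part_def)
      then have "(b, c) \<in> K"
        using I(1) bracket_join_upper[of "real_part n I" "real_part n ` X"] by (auto simp: K_def)
      with \<open>(a, b) \<in> K\<close> show ?case by (rule bracket_trans[OF K])
    qed
  qed
  have "(a, b) \<in> K" if ab: "(a, b) \<in> real_part n J" for a b
  proof (cases "b < a + int n")
    case True
    then show ?thesis using short that by (auto simp: real_part_def)
  next
    case False
    then obtain c where c: "\<not> int n dvd c - a" "(c, c + int n) \<in> J" and abJ: "(a, b) \<in> J"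
      using ab by (auto simp: real_part_def)
    obtain d where d: "a < d" "d < a + int n" "(d, d + int n) \<in> J"
      using bracket_shift_into_period[OF n J c(2,1)] .
    \<comment> \<open>The long step from \<open>a\<close> to \<open>a + n\<close> factors through \<open>d\<close> into two short ones.\<close>
    have "(a, d) \<in> K"
      using short bracket_shrink[OF J abJ d(1)] False d(2) by simp
    moreover have "(d, a + int n) \<in> K"
      using short bracket_shrink[OF J d(3,2)] d(1) by simp
    ultimately have "(a, a + int n) \<in> K" by (rule bracket_trans[OF K])
    then show ?thesis using bracket_waning[OF K] bracket_less[OF J abJ] by blast
  qed
  then show "real_part n (bracket_join X) \<subseteq> bracket_join (real_part n ` X)"
    by (auto simp: J_def K_def)
  have "K \<subseteq> real_part n J"
    unfolding K_def
  proof (rule bracket_join_least[OF bracket_real_part[OF n J]])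
    fix I assume "I \<in> real_part n ` X"
    then show "I \<subseteq> real_part n J"
      using real_part_mono bracket_join_upper by (auto simp: J_def; blast)
  qed
  then show "bracket_join (real_part n ` X) \<subseteq> real_part n (bracket_join X)"
    by (simp add: J_def K_def)
qed

lemma real_part_fixed_iff:
  assumes n: "n > 0" and J: "bracket n J"
  shows "real_part n J = J \<longleftrightarrow>
    (\<forall>a. (a, a + int n) \<in> J \<longrightarrow> (\<exists>c. \<not> int n dvd c - a \<and> (c, c + int n) \<in> J))"
proof
  assume "real_part n J = J"
  then show "\<forall>a. (a, a + int n) \<in> J \<longrightarrow> (\<exists>c. \<not> int n dvd c - a \<and> (c, c + int n) \<in> J)"
    by (auto simp: real_part_def set_eq_iff)
next
  assume two: "\<forall>a. (a, a + int n) \<in> J \<longrightarrow> (\<exists>c. \<not> int n dvd c - a \<and> (c, c + int n) \<in> J)"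
  have "(a, b) \<in> real_part n J" if "(a, b) \<in> J" for a b
  proof (cases "b < a + int n")
    case False
    then have "(a, a + int n) \<in> J"
      using bracket_shrink[OF J that, of "a + int n"] n by simp
    then show ?thesis using that two by (auto simp: real_part_def)
  qed (use that in \<open>auto simp: real_part_def\<close>)
  then show "real_part n J = J" using real_part_subset by fast
qed

text \<open>
  In a waning class every element comes after all larger integers. An element \<open>z\<close> placed after a
  member \<open>x\<close> of the class is then preceded by \<open>x + n\<close>, which forces \<open>z\<close> to be waning. If the
  class is the only waning one, nothing can separate its elements.
\<close>

lemma block_of_residue_class:
  assumes n: "n > 0" and r: "tito n r" and J: "bracket n (inverted_pairs r)"
    and a: "(a, a + int n) \<in> inverted_pairs r"
    and only: "\<And>c. (c, c + int n) \<in> inverted_pairs r \<Longrightarrow> int n dvd c - a"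
  shows "block r {x. int n dvd x - a}"
proof -
  define J where "J = inverted_pairs r"
  define I where "I = {x. int n dvd x - a}"
  note J' = J[folded J_def]
  have I_shift: "x + k * int n \<in> I \<longleftrightarrow> x \<in> I" for x k
    by (simp add: I_def diff_add_eq[symmetric])
  have wan: "(x, x + int n) \<in> J" if xI: "x \<in> I" for x
  proof -
    from xI obtain k where "x - a = int n * k" unfolding I_def by (auto elim: dvdE)
    then have "x = a + k * int n" by (simp add: algebra_simps)
    moreover from this have "x + int n = (a + int n) + k * int n" by simp
    ultimately show ?thesis using a bracket_shift[OF J'] unfolding J_def by metis
  qed
  have after: "y \<le> x" if "x \<in> I" "(x, y) \<in> r" for x y
  proof (rule ccontr)
    assume "\<not> y \<le> x"
    then have "(x, y) \<in> J" using bracket_waning[OF J' wan[OF that(1)]] by simp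
    then have "(y, x) \<in> r" by (simp add: J_def inverted_pairs_def)
    then have "x = y" using tito_antisym[OF r] that(2) by blast
    then show False using \<open>\<not> y \<le> x\<close> by simp
  qed
  have "order_convex r I"
    unfolding order_convex_def
  proof (intro ballI allI impI, elim conjE)
    fix x y z assume x: "x \<in> I" and xz: "(x, z) \<in> r"
    have "z \<le> x" by (rule after[OF x xz])
    have "(z, x + int n) \<in> J"
    proof -
      have "(x + int n, x) \<in> r" using wan[OF x] by (simp add: J_def inverted_pairs_def)
      then have "(x + int n, z) \<in> r" using xz by (rule tito_trans[OF r])
      then show ?thesis using \<open>z \<le> x\<close> n by (simp add: J_def inverted_pairs_def)
    qed
    then have "(z, z + int n) \<in> J"
      using bracket_shrink[OF J', of z "x + int n" "z + int n"] \<open>z \<le> x\<close> n by simp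
    then show "z \<in> I" using only by (simp add: I_def J_def)
  qed
  moreover have "a \<in> I" by (simp add: I_def)
  then have "I \<noteq> {}" by blast
  moreover have "\<not> (\<exists>m\<in>I. \<forall>x\<in>I. (m, x) \<in> r)"
  proof
    assume "\<exists>m\<in>I. \<forall>x\<in>I. (m, x) \<in> r"
    then obtain x where "x \<in> I" "(x, x + int n) \<in> r" using I_shift[of _ 1] by auto
    then show False using after n by fastforce
  qed
  moreover have "\<not> (\<exists>m\<in>I. \<forall>x\<in>I. (x, m) \<in> r)"
  proof
    assume "\<exists>m\<in>I. \<forall>x\<in>I. (x, m) \<in> r"
    then obtain x where "x - int n \<in> I" "(x - int n, x) \<in> r" using I_shift[of _ "- 1"] by auto
    then show False using after n by fastforce
  qed
  moreover have "finite {z. (x, z) \<in> r \<and> (z, y) \<in> r}" if xy: "x \<in> I" "y \<in> I" for x y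
  proof (rule finite_subset)
    show "{z. (x, z) \<in> r \<and> (z, y) \<in> r} \<subseteq> {y..x}"
    proof clarify
      fix z assume z: "(x, z) \<in> r" "(z, y) \<in> r"
      have "z \<in> I" using \<open>order_convex r I\<close> xy z unfolding order_convex_def by blast
      then show "z \<in> {y..x}" using after xy z by simp
    qed
  qed simp
  ultimately show ?thesis unfolding block_def I_def[symmetric] by blast
qed

text \<open>
  If the class of \<open>a\<close> is the only waning one, it is a waning block of size one. Conversely, if
  \<open>a\<close> is waning and \<open>d\<close> in a second waning class lies between \<open>a\<close> and \<open>a + n\<close>, then \<open>d\<close> is
  placed between \<open>a + n\<close> and \<open>a\<close> in the order, so no block of size one contains \<open>a\<close>.
\<close>

lemma real_tito_iff_real_part:
  assumes n: "n > 0" and r: "tito n r" and av: "avoids_312 r"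
  shows "real_tito n r \<longleftrightarrow> real_part n (inverted_pairs r) = inverted_pairs r"
proof -
  define J where "J = inverted_pairs r"
  have J: "bracket n J" unfolding J_def by (rule bracket_inverted_pairs[OF r av])
  have "(\<forall>I. block r I \<and> block_size n I = 1 \<longrightarrow> waxing n r I) \<longleftrightarrow> real_part n J = J"
  proof
    assume real: "\<forall>I. block r I \<and> block_size n I = 1 \<longrightarrow> waxing n r I"
    show "real_part n J = J"
      unfolding real_part_fixed_iff[OF n J]
    proof (intro allI impI, rule ccontr)
      fix a assume a: "(a, a + int n) \<in> J"
        and "\<not> (\<exists>c. \<not> int n dvd c - a \<and> (c, c + int n) \<in> J)"
      then have "block r {x. int n dvd x - a}"
        using block_of_residue_class[OF n r] J unfolding J_def by blast
      moreover have "(\<lambda>x. x mod int n) ` {x. int n dvd x - a} = {a mod int n}"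
        by (auto simp: mod_eq_dvd_iff image_iff intro: exI[of _ a])
      then have "block_size n {x. int n dvd x - a} = 1"
        by (simp add: block_size_def)
      ultimately have "(a, a + int n) \<in> r" using real by (auto simp: waxing_def)
      moreover have "(a + int n, a) \<in> r" using a by (simp add: J_def inverted_pairs_def)
      ultimately show False using tito_antisym[OF r] n by fastforce
    qed
  next
    assume fixed: "real_part n J = J"
    show "\<forall>I. block r I \<and> block_size n I = 1 \<longrightarrow> waxing n r I"
    proof (intro allI impI)
      fix I assume I: "block r I \<and> block_size n I = 1"
      then obtain t where t: "(\<lambda>x. x mod int n) ` I = {t}"
        by (auto simp: block_size_def card_1_singleton_iff)
      have same: "int n dvd x - y" if "x \<in> I" "y \<in> I" for x y
      proof -
        have "x mod int n = t" "y mod int n = t" using t that by blast+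
        then show ?thesis by (simp add: mod_eq_dvd_iff[symmetric])
      qed
      show "waxing n r I"
        unfolding waxing_def
      proof (rule ballI, rule ccontr)
        fix a assume a: "a \<in> I" and "(a, a + int n) \<notin> r"
        then have aJ: "(a, a + int n) \<in> J"
          using tito_mem_iff[OF r, of a "a + int n"] n by (auto simp: J_def)
        then obtain c where c: "\<not> int n dvd c - a" "(c, c + int n) \<in> J"
          using fixed real_part_fixed_iff[OF n J] by blast
        obtain d where d: "a < d" "d < a + int n" "(d, d + int n) \<in> J"
          using bracket_shift_into_period[OF n J c(2,1)] .
        have dr: "(d, a) \<in> r" "(a + int n, d) \<in> r"
          using bracket_shrink[OF J aJ d(1)] bracket_shrink[OF J d(3,2)] d
          by (auto simp: J_def inverted_pairs_def)
        \<comment> \<open>As \<open>I\<close> has no minimum, it has an element \<open>x\<close> preceding \<open>a\<close>; then \<open>d\<close> lies between \<open>x\<close> and \<open>a\<close>.\<close>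
        obtain x where x: "x \<in> I" "(a, x) \<notin> r"
          using I a unfolding block_def by blast
        then have xa: "(x, a) \<in> r" "x \<noteq> a" using tito_total[OF r] tito_refl[OF r] by blast+
        have "a < x"
        proof (rule ccontr)
          assume "\<not> a < x"
          then have xlt: "x < a" using xa(2) by simp
          have "int n dvd x - a" by (rule same[OF x(1) a])
          then obtain k where k: "x - a = int n * k" by (rule dvdE)
          have xk: "x = a + k * int n" using k by (simp add: algebra_simps)
          have "(x, x + int n) \<in> J"
            using bracket_shift[OF J, of a k "a + int n"] aJ unfolding xk
            by (simp add: algebra_simps)
          then have "(x, a) \<in> J" using bracket_waning[OF J] xlt by blast
          then show False using x(2) by (simp add: J_def inverted_pairs_def)
        qed
        moreover have "int n dvd x - a" by (rule same[OF x(1) a])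
        ultimately have "a + int n \<le> x" using zdvd_imp_le[of "int n" "x - a"] by simp
        then have "(x, d) \<in> r"
        proof -
          have "d < x" using d \<open>a + int n \<le> x\<close> by simp
          then have "(d, x) \<in> J" using bracket_waning[OF J d(3)] by blast
          then show ?thesis by (simp add: J_def inverted_pairs_def)
        qed
        then have "d \<in> I"
          using I x(1) a dr(1) unfolding block_def order_convex_def by blast
        then have "int n dvd d - a" using same a by blast
        then show False using d zdvd_not_zless[of "d - a" "int n"] by simp
      qed
    qed
  qed
  then show ?thesis using r by (simp add: real_tito_def J_def)
qed


section \<open>The two Tamari lattices\<close>

theorem mainTheorem19:
  fixes n :: nat
  assumes "n \<ge> 2"
  shows "finite_lattice (CTam312 n) \<and> semidistributive (CTam312 n) \<and>
         finite_lattice (ATam312 n) \<and> semidistributive (ATam312 n)"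
proof -
  have n: "n > 0" using assms by simp
  interpret cyclic: bracket_coreflection n "\<lambda>J. J"
    using n by unfold_locales auto
  interpret affine: bracket_coreflection n "real_part n"
    using n bracket_real_part real_part_subset real_part_mono real_part_idem real_part_join
    by unfold_locales auto
  have "finite_lattice (CTam312 n) \<and> semidistributive (CTam312 n)"
    unfolding CTam312_def by (rule cyclic.semidistributive_inversion_order) simp
  moreover have "finite_lattice (ATam312 n) \<and> semidistributive (ATam312 n)"
    unfolding ATam312_def
    by (rule affine.semidistributive_inversion_order)
      (use real_tito_iff_real_part[OF n] in \<open>auto simp: real_tito_def\<close>)
  ultimately show ?thesis by blast
qed

end
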